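(* Let $0 < \varepsilon_a < 1$, $0 < \varepsilon_r < 1$ and $0 \leq a < \frac{\varepsilon_a}{\varepsilon_r} < b$, and let $n$ be a positive integer. Let $X_1, \ldots, X_n$ be independent and identically distributed Poisson random variables with mean $\lambda \in [a,b]$, and let $\widehat{\lambda}_n = \frac{1}{n}\sum_{i=1}^n X_i$. Then the minimum of $$\Pr\left\{ |\widehat{\lambda}_n - \lambda| < \varepsilon_a \ \text{ or } \ \left| \frac{\widehat{\lambda}_n - \lambda}{\lambda} \right| < \varepsilon_r \right\}$$ with respect to $\lambda \in [a,b]$ is achieved at (an element of) the finite set $$\left\{a, b, \tfrac{\varepsilon_a}{\varepsilon_r}\right\} \cup \left\{ \tfrac{\ell}{n} + \varepsilon_a \in \left(a, \tfrac{\varepsilon_a}{\varepsilon_r}\right) : \ell \in \mathbb{Z} \right\} \cup \left\{ \tfrac{\ell}{n} - \varepsilon_a \in \left(a, \tfrac{\varepsilon_a}{\varepsilon_r}\right) : \ell \in \mathbb{Z} \right\} \cup \left\{ \tfrac{\ell}{n(1+\varepsilon_r)} \in \left(\tfrac{\varepsilon_a}{\varepsilon_r}, b\right) : \ell \in \mathbb{Z} \right\} \cup \left\{ \tfrac{\ell}{n(1-\varepsilon_r)} \in \left(\tfrac{\varepsilon_a}{\varepsilon_r}, b\right) : \ell \in \mathbb{Z} \right\},$$ which has less than $2n(b-a) + 7$ elements.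
   Context: For each $\lambda$, the probability is computed under the assumption that $X_1,\ldots,X_n$ are i.i.d. Poisson with mean $\lambda$, i.e. $\Pr\{X_i = k\} = \frac{\lambda^k e^{-\lambda}}{k!}$ for $k = 0,1,\ldots$; so it is a function of $\lambda \in [a,b]$ with $n$, $\varepsilon_a$, $\varepsilon_r$ fixed. When $\lambda = 0$ (possible if $a = 0$), a Poisson variable of mean $0$ is identically $0$ almost surely, and the event is understood to be just $|\widehat{\lambda}_n - \lambda| < \varepsilon_a$. *)

theory Defs
  imports "HOL-Probability.Probability"
begin

text \<open>The probability mass function is written out because the library's \<open>poisson_pmf\<close> is specified
  only for a positive rate. For \<open>lam = 0\<close> the convention \<open>0 ^ 0 = 1\<close> yields the
  point mass at 0.\<close>

definition poisson_variable :: "'a measure \<Rightarrow> ('a \<Rightarrow> nat) \<Rightarrow> real \<Rightarrow> bool" where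
  "poisson_variable M Y lam \<longleftrightarrow>
     Y \<in> measurable M (count_space UNIV) \<and>
     (\<forall>k. measure M {\<omega> \<in> space M. Y \<omega> = k} = lam ^ k * exp (- lam) / fact k)"

definition iid_poisson :: "'a measure \<Rightarrow> (nat \<Rightarrow> 'a \<Rightarrow> nat) \<Rightarrow> nat \<Rightarrow> real \<Rightarrow> bool" where
  "iid_poisson M X n lam \<longleftrightarrow>
     prob_space M \<and>
     prob_space.indep_vars M (\<lambda>_. count_space UNIV) X {1..n} \<and>
     (\<forall>i\<in>{1..n}. poisson_variable M (X i) lam)"

definition sample_mean :: "(nat \<Rightarrow> 'a \<Rightarrow> nat) \<Rightarrow> nat \<Rightarrow> 'a \<Rightarrow> real" where
  "sample_mean X n \<omega> = (\<Sum>i = 1..n. real (X i \<omega>)) / real n"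

text \<open>The guard \<open>lam \<noteq> 0\<close> drops the relative-error criterion at \<open>lam = 0\<close>,
  where \<open>x / 0 = 0\<close> would otherwise make it always true.\<close>

definition coverage_probability ::
    "'a measure \<Rightarrow> (nat \<Rightarrow> 'a \<Rightarrow> nat) \<Rightarrow> nat \<Rightarrow> real \<Rightarrow> real \<Rightarrow> real \<Rightarrow> real" where
  "coverage_probability M X n \<epsilon>a \<epsilon>r lam =
     measure M {\<omega> \<in> space M.
       \<bar>sample_mean X n \<omega> - lam\<bar> < \<epsilon>a \<or>
       (lam \<noteq> 0 \<and> \<bar>(sample_mean X n \<omega> - lam) / lam\<bar> < \<epsilon>r)}"

definition candidate_set :: "nat \<Rightarrow> real \<Rightarrow> real \<Rightarrow> real \<Rightarrow> real \<Rightarrow> real set" where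
  "candidate_set n a b \<epsilon>a \<epsilon>r =
     {a, b, \<epsilon>a / \<epsilon>r}
     \<union> {x \<in> {a<..<\<epsilon>a / \<epsilon>r}. \<exists>l::int. x = of_int l / real n + \<epsilon>a}
     \<union> {x \<in> {a<..<\<epsilon>a / \<epsilon>r}. \<exists>l::int. x = of_int l / real n - \<epsilon>a}
     \<union> {x \<in> {\<epsilon>a / \<epsilon>r<..<b}. \<exists>l::int. x = of_int l / (real n * (1 + \<epsilon>r))}
     \<union> {x \<in> {\<epsilon>a / \<epsilon>r<..<b}. \<exists>l::int. x = of_int l / (real n * (1 - \<epsilon>r))}"

end

theory Submission
  imports Defs
begin

text \<open>The sum \<open>K\<close> of the sample is Poisson with mean \<open>n \<lambda>\<close>, and coverage means that \<open>K\<close> lies in the set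
  of all \<open>k\<close> with \<open>\<bar>k / n - \<lambda>\<bar> < max \<epsilon>a (\<epsilon>r * \<lambda>)\<close>, a finite interval of naturals. Both ends of this
  interval increase with \<open>\<lambda>\<close>, and the interval changes only when one of the ends crosses an integer,
  which happens only at candidates. Between two adjacent candidates the coverage probability is
  therefore \<open>\<Sum>k = c..d. exp (- \<mu>) * \<mu> ^ k / k!\<close> with constant \<open>c\<close>, \<open>d\<close> and \<open>\<mu> = n \<lambda>\<close>; this function first
  increases and then decreases. At the candidates themselves the interval can only lose elements, as
  the inequality defining it is strict.\<close>

section \<open>Poisson masses and sums of independent Poisson variables\<close>

definition poisson_mass :: "nat \<Rightarrow> real \<Rightarrow> real" where
  "poisson_mass k \<mu> = \<mu> ^ k * exp (- \<mu>) / fact k"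

lemma poisson_mass_nonneg: "0 \<le> \<mu> \<Longrightarrow> 0 \<le> poisson_mass k \<mu>"
  by (simp add: poisson_mass_def)

text \<open>The convolution identity is the binomial theorem: dividing \<open>k choose j\<close> by
  \<open>fact k\<close> leaves \<open>1 / (fact j * fact (k - j))\<close>, so each term splits into
  a product of two masses.\<close>

lemma poisson_mass_add:
  "poisson_mass k (\<mu> + \<nu>) = (\<Sum>j\<le>k. poisson_mass j \<mu> * poisson_mass (k - j) \<nu>)"
proof -
  have "poisson_mass k (\<mu> + \<nu>)
      = (\<Sum>j\<le>k. of_nat (k choose j) * \<mu> ^ j * \<nu> ^ (k - j)) * exp (- (\<mu> + \<nu>)) / fact k"
    unfolding poisson_mass_def by (subst binomial_ring) simp
  also have "\<dots> = (\<Sum>j\<le>k. of_nat (k choose j) * \<mu> ^ j * \<nu> ^ (k - j) * exp (- (\<mu> + \<nu>)) / fact k)"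
    by (simp add: sum_distrib_right sum_divide_distrib)
  also have "\<dots> = (\<Sum>j\<le>k. poisson_mass j \<mu> * poisson_mass (k - j) \<nu>)"
  proof (intro sum.cong refl)
    fix j assume "j \<in> {..k}"
    then have "real (k choose j) / fact k = 1 / (fact j * fact (k - j))"
      by (simp add: binomial_fact)
    moreover have "exp (- (\<mu> + \<nu>)) = exp (- \<mu>) * exp (- \<nu>)"
      by (simp only: minus_add_distrib exp_add)
    moreover have "real (k choose j) * \<mu> ^ j * \<nu> ^ (k - j) * exp (- (\<mu> + \<nu>)) / fact k
        = real (k choose j) / fact k * (\<mu> ^ j * \<nu> ^ (k - j)) * exp (- (\<mu> + \<nu>))"
      by simp
    ultimately show "real (k choose j) * \<mu> ^ j * \<nu> ^ (k - j) * exp (- (\<mu> + \<nu>)) / fact k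
        = poisson_mass j \<mu> * poisson_mass (k - j) \<nu>"
      by (simp only:) (simp add: poisson_mass_def mult_ac)
  qed
  finally show ?thesis .
qed

lemma poisson_variable_iff:
  "poisson_variable M Y \<mu> \<longleftrightarrow> Y \<in> measurable M (count_space UNIV) \<and>
     (\<forall>k. measure M {\<omega> \<in> space M. Y \<omega> = k} = poisson_mass k \<mu>)"
  by (simp add: poisson_variable_def poisson_mass_def)

context prob_space
begin

lemma poisson_variable_add:
  assumes ind: "indep_var (count_space UNIV) Y (count_space UNIV) Z"
    and Y: "poisson_variable M Y \<mu>" and Z: "poisson_variable M Z \<nu>"
  shows "poisson_variable M (\<lambda>\<omega>. Y \<omega> + Z \<omega>) (\<mu> + \<nu>)"
proof -
  have [measurable]: "Y \<in> measurable M (count_space UNIV)" "Z \<in> measurable M (count_space UNIV)"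
    using Y Z by (auto simp: poisson_variable_iff)
  have "prob {\<omega> \<in> space M. Y \<omega> + Z \<omega> = k} = poisson_mass k (\<mu> + \<nu>)" for k
  proof -
    have joint: "prob {\<omega> \<in> space M. Y \<omega> = i \<and> Z \<omega> = j} = poisson_mass i \<mu> * poisson_mass j \<nu>" for i j
    proof -
      have "prob ((\<lambda>x. (Y x, Z x)) -` ({i} \<times> {j}) \<inter> space M)
          = prob (Y -` {i} \<inter> space M) * prob (Z -` {j} \<inter> space M)"
        by (rule indep_varD[OF ind]) auto
      moreover have "(\<lambda>x. (Y x, Z x)) -` ({i} \<times> {j}) \<inter> space M = {\<omega> \<in> space M. Y \<omega> = i \<and> Z \<omega> = j}"
        "Y -` {i} \<inter> space M = {\<omega> \<in> space M. Y \<omega> = i}" "Z -` {j} \<inter> space M = {\<omega> \<in> space M. Z \<omega> = j}"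
        by auto
      ultimately show ?thesis using Y Z by (simp add: poisson_variable_iff)
    qed
    have "{\<omega> \<in> space M. Y \<omega> + Z \<omega> = k} = (\<Union>j\<le>k. {\<omega> \<in> space M. Y \<omega> = j \<and> Z \<omega> = k - j})"
      by auto
    then have "prob {\<omega> \<in> space M. Y \<omega> + Z \<omega> = k} = (\<Sum>j\<le>k. prob {\<omega> \<in> space M. Y \<omega> = j \<and> Z \<omega> = k - j})"
      by (simp, intro finite_measure_finite_Union) (auto simp: disjoint_family_on_def)
    then show ?thesis by (simp add: joint poisson_mass_add)
  qed
  then show ?thesis by (simp add: poisson_variable_iff)
qed

lemma poisson_variable_sum:
  assumes "finite I" "indep_vars (\<lambda>_. count_space UNIV) X I"
    and "\<And>i. i \<in> I \<Longrightarrow> poisson_variable M (X i) (r i)"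
  shows "poisson_variable M (\<lambda>\<omega>. \<Sum>i\<in>I. X i \<omega>) (\<Sum>i\<in>I. r i)"
  using assms
proof (induction I)
  case empty
  \<comment> \<open>Since \<open>0 ^ 0 = 1\<close>, the mass with mean 0 is the point mass at 0,
    which is the distribution of the empty sum.\<close>
  have "prob {\<omega> \<in> space M. 0 = k} = poisson_mass k 0" for k :: nat
    by (cases "k = 0") (auto simp: poisson_mass_def prob_space power_0_left)
  then show ?case by (simp add: poisson_variable_iff)
next
  case (insert i I)
  \<comment> \<open>\<open>indep_vars_sum\<close> speaks of real-valued variables, so the counts
    pass through the reals; composing both variables with \<open>nat\<close> of the floor restores
    the naturals and preserves independence.\<close>
  have "indep_vars (\<lambda>_. borel) (\<lambda>i \<omega>. real (X i \<omega>)) (insert i I)"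
    by (rule indep_vars_compose2[OF insert.prems(1)]) simp
  then have "indep_var borel (\<lambda>\<omega>. real (X i \<omega>)) borel (\<lambda>\<omega>. \<Sum>i\<in>I. real (X i \<omega>))"
    by (rule indep_vars_sum[OF insert.hyps])
  moreover have "(\<lambda>x::real. nat \<lfloor>x\<rfloor>) \<in> measurable borel (count_space UNIV)"
    by measurable
  ultimately have "indep_var (count_space UNIV) ((\<lambda>x::real. nat \<lfloor>x\<rfloor>) \<circ> (\<lambda>\<omega>. real (X i \<omega>)))
      (count_space UNIV) ((\<lambda>x::real. nat \<lfloor>x\<rfloor>) \<circ> (\<lambda>\<omega>. \<Sum>i\<in>I. real (X i \<omega>)))"
    by (intro indep_var_compose)
  then have "indep_var (count_space UNIV) (X i) (count_space UNIV) (\<lambda>\<omega>. \<Sum>i\<in>I. X i \<omega>)"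
    by (simp add: comp_def flip: of_nat_sum)
  moreover have "indep_vars (\<lambda>_. count_space UNIV) X I"
    using indep_vars_subset[OF insert.prems(1)] by blast
  ultimately have "poisson_variable M (\<lambda>\<omega>. X i \<omega> + (\<Sum>i\<in>I. X i \<omega>)) (r i + (\<Sum>i\<in>I. r i))"
    using insert.IH insert.prems(2) by (intro poisson_variable_add) auto
  then show ?case using insert.hyps by simp
qed

lemma poisson_variable_prob_in:
  assumes "poisson_variable M Y \<mu>" "finite S"
  shows "prob {\<omega> \<in> space M. Y \<omega> \<in> S} = (\<Sum>k\<in>S. poisson_mass k \<mu>)"
proof -
  have [measurable]: "Y \<in> measurable M (count_space UNIV)"
    using assms by (auto simp: poisson_variable_iff)
  have "{\<omega> \<in> space M. Y \<omega> \<in> S} = (\<Union>k\<in>S. {\<omega> \<in> space M. Y \<omega> = k})"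
    by auto
  then have "prob {\<omega> \<in> space M. Y \<omega> \<in> S} = (\<Sum>k\<in>S. prob {\<omega> \<in> space M. Y \<omega> = k})"
    using assms by (simp, intro finite_measure_finite_Union) (auto simp: disjoint_family_on_def)
  then show ?thesis using assms by (simp add: poisson_variable_iff)
qed

end

section \<open>Unimodality of Poisson sums over a fixed range\<close>

text \<open>The derivative of mass \<open>k\<close> is mass \<open>k - 1\<close> minus mass
  \<open>k\<close>, so the sum telescopes. The case \<open>c = 0\<close> is split off because there
  the lower term is 0, whereas \<open>c - 1\<close> would truncate to index 0.\<close>

lemma DERIV_sum_poisson_mass:
  assumes "c \<le> d"
  shows "((\<lambda>\<mu>. \<Sum>k = c..d. poisson_mass k \<mu>) has_real_derivative
           (if c = 0 then 0 else poisson_mass (c - 1) x) - poisson_mass d x) (at x)"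
proof -
  have deriv: "(poisson_mass k has_real_derivative
      (if k = 0 then 0 else poisson_mass (k - 1) x) - poisson_mass k x) (at x)" for k
  proof (cases k)
    case 0
    then show ?thesis unfolding poisson_mass_def by (auto intro!: derivative_eq_intros)
  next
    case (Suc j)
    have "((\<lambda>\<mu>. \<mu> ^ Suc j * exp (- \<mu>) / fact (Suc j)) has_real_derivative
        (real (Suc j) * x ^ j * exp (- x) - x ^ Suc j * exp (- x)) / fact (Suc j)) (at x)"
      by (auto intro!: derivative_eq_intros simp del: fact_Suc, cases j, auto simp: algebra_simps)
    moreover have "(real (Suc j) * x ^ j * exp (- x) - x ^ Suc j * exp (- x)) / fact (Suc j)
        = poisson_mass j x - poisson_mass (Suc j) x"
      by (simp add: poisson_mass_def diff_divide_distrib mult.assoc del: of_nat_Suc power_Suc)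
    ultimately show ?thesis using Suc by (simp add: poisson_mass_def[abs_def] del: fact_Suc power_Suc)
  qed
  show ?thesis
    using assms
  proof (induction d rule: dec_induct)
    case base
    then show ?case using deriv[of c] by simp
  next
    case (step d)
    then show ?case using DERIV_add[OF step.IH deriv[of "Suc d"]] by simp
  qed
qed

text \<open>For \<open>0 < c \<le> d\<close> the derivative is
  \<open>x ^ (c - 1) * exp (- x)\<close> times a difference that decreases in
  \<open>x \<ge> 0\<close>; for \<open>c = 0\<close> it is nonpositive. Its sign thus changes at
  most once, from plus to minus, and \<open>\<mu>\<close> lies either on a rising stretch starting
  at \<open>u\<close> or on a falling stretch ending at \<open>v\<close>.\<close>

lemma sum_poisson_mass_quasi_concave:
  assumes "0 \<le> u" "u \<le> \<mu>" "\<mu> \<le> v"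
  shows "min (\<Sum>k = c..d. poisson_mass k u) (\<Sum>k = c..d. poisson_mass k v)
      \<le> (\<Sum>k = c..d. poisson_mass k \<mu>)"
proof (cases "c \<le> d")
  case True
  define D where "D x = (if c = 0 then 0 else poisson_mass (c - 1) x) - poisson_mass d x" for x
  have deriv: "((\<lambda>\<mu>. \<Sum>k = c..d. poisson_mass k \<mu>) has_real_derivative D x) (at x)" for x
    unfolding D_def by (rule DERIV_sum_poisson_mass[OF True])
  \<comment> \<open>In contrapositive form: once negative, \<open>D\<close> stays negative. The
    condition \<open>0 < y\<close> excludes the zero that the factor \<open>y ^ (c - 1)\<close> can
    have at 0.\<close>
  have sign: "0 \<le> D x" if "0 \<le> x" "x \<le> y" "0 \<le> D y" "0 < y" for x y
  proof (cases "c = 0")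
    case True
    \<comment> \<open>For \<open>c = 0\<close> this makes \<open>D y\<close> negative, so the
      premises contradict each other.\<close>
    have "0 < poisson_mass d y" using that by (simp add: poisson_mass_def)
    then show ?thesis using that True by (simp add: D_def)
  next
    case False
    \<comment> \<open>The exponent left in the mass of index \<open>d\<close> after the common power
      \<open>z ^ (c - 1)\<close> is taken out.\<close>
    define m where "m = d - (c - 1)"
    have D_eq: "D z = z ^ (c - 1) * exp (- z) * (1 / fact (c - 1) - z ^ m / fact d)" for z
    proof -
      have "z ^ d = z ^ (c - 1) * z ^ m"
        using True by (simp add: m_def flip: power_add)
      then show ?thesis using False by (simp add: D_def poisson_mass_def algebra_simps)
    qed
    have "0 \<le> 1 / fact (c - 1) - y ^ m / fact d"
    proof (rule ccontr)
      assume "\<not> ?thesis"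
      moreover have "0 < y ^ (c - 1) * exp (- y)"
        using \<open>0 < y\<close> by simp
      ultimately have "D y < 0"
        unfolding D_eq by (simp only: not_le mult_pos_neg)
      with that show False by linarith
    qed
    moreover have "x ^ m / fact d \<le> y ^ m / fact d"
      using that by (intro divide_right_mono power_mono) auto
    ultimately show ?thesis unfolding D_eq using that by (intro mult_nonneg_nonneg) auto
  qed
  show ?thesis
  \<comment> \<open>\<open>sign\<close> asks for a positive right-hand point;
    \<open>\<mu> = 0\<close> forces \<open>u = \<mu>\<close>, where the bound is trivial.\<close>
  proof (cases "\<mu> = 0")
    case True
    then show ?thesis using assms by simp
  next
    case False
    show ?thesis
    proof (cases "0 \<le> D \<mu>")
      case True
      have "0 \<le> D x" if "u \<le> x" "x \<le> \<mu>" for x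
        using that assms False True by (intro sign[of x \<mu>]) auto
      then have "(\<Sum>k = c..d. poisson_mass k u) \<le> (\<Sum>k = c..d. poisson_mass k \<mu>)"
        using assms deriv
        by (intro DERIV_nonneg_imp_nondecreasing[where f = "\<lambda>\<mu>. \<Sum>k = c..d. poisson_mass k \<mu>"]) blast+
      then show ?thesis by linarith
    next
      case neg: False
      have "D x \<le> 0" if "\<mu> \<le> x" for x
      proof (rule ccontr)
        assume "\<not> ?thesis"
        then have "0 \<le> D \<mu>"
          using that assms False by (intro sign[of \<mu> x]) auto
        with neg show False by simp
      qed
      then have "(\<Sum>k = c..d. poisson_mass k v) \<le> (\<Sum>k = c..d. poisson_mass k \<mu>)"
        using assms deriv
        by (intro DERIV_nonpos_imp_nonincreasing[where f = "\<lambda>\<mu>. \<Sum>k = c..d. poisson_mass k \<mu>"]) blast+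
      then show ?thesis by linarith
    qed
  qed
qed simp

section \<open>The set of covered counts\<close>

text \<open>Multiplying the relative criterion by \<open>lam > 0\<close> merges both criteria into
  one strict inequality with a maximum. For \<open>0 < \<epsilon>a\<close> and
  \<open>lam = 0\<close> the maximum is \<open>\<epsilon>a\<close>, in agreement with the guard in
  \<open>coverage_probability\<close>.\<close>

definition covered_counts :: "nat \<Rightarrow> real \<Rightarrow> real \<Rightarrow> real \<Rightarrow> nat set" where
  "covered_counts n \<epsilon>a \<epsilon>r lam = {k. \<bar>real k / real n - lam\<bar> < max \<epsilon>a (\<epsilon>r * lam)}"

text \<open>The condition bounds \<open>k\<close> from above and is convex in \<open>k\<close>, so a
  nonempty set is the interval from its minimum to its maximum; \<open>{1..0}\<close> serves for the
  empty set.\<close>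

lemma covered_counts_interval:
  assumes "0 < n"
  obtains c d where "covered_counts n \<epsilon>a \<epsilon>r lam = {c..d}"
proof -
  define S where "S = covered_counts n \<epsilon>a \<epsilon>r lam"
  have "k < nat \<lceil>real n * (lam + max \<epsilon>a (\<epsilon>r * lam))\<rceil>" if "k \<in> S" for k
  proof -
    have "real k / real n < lam + max \<epsilon>a (\<epsilon>r * lam)"
      using that by (auto simp: S_def covered_counts_def)
    then have "real k < real n * (lam + max \<epsilon>a (\<epsilon>r * lam))"
      using assms by (simp add: pos_divide_less_eq mult.commute)
    then show ?thesis by linarith
  qed
  then have fin: "finite S"
    by (meson finite_lessThan finite_subset lessThan_iff subsetI)
  show thesis
  proof (cases "S = {}")
    case True
    then show thesis using that[of 1 0] by (simp add: S_def)
  next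
    case False
    have "S = {Min S..Max S}"
    proof (intro equalityI subsetI)
      fix k assume "k \<in> {Min S..Max S}"
      then have "real (Min S) / real n \<le> real k / real n" "real k / real n \<le> real (Max S) / real n"
        by (auto intro!: divide_right_mono)
      moreover have "Min S \<in> S" "Max S \<in> S"
        using fin False by simp_all
      moreover define m where "m = max \<epsilon>a (\<epsilon>r * lam)"
      moreover have "S = {k. \<bar>real k / real n - lam\<bar> < m}"
        by (simp add: S_def covered_counts_def m_def)
      ultimately show "k \<in> S"
        unfolding abs_less_iff by (simp only: mem_Collect_eq) linarith
    qed (use fin in simp)
    then show thesis using that unfolding S_def by blast
  qed
qed

text \<open>This removes the probability space, which may vary with \<open>lam\<close>, and leaves
  an explicit function of \<open>lam\<close> to minimize.\<close>

lemma coverage_probability_eq_sum: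
  assumes "iid_poisson M X n lam" "0 < n" "0 \<le> lam" "0 < \<epsilon>a"
  shows "coverage_probability M X n \<epsilon>a \<epsilon>r lam
       = (\<Sum>k \<in> covered_counts n \<epsilon>a \<epsilon>r lam. poisson_mass k (real n * lam))"
proof -
  interpret prob_space M using assms by (simp add: iid_poisson_def)
  have "poisson_variable M (\<lambda>\<omega>. \<Sum>i = 1..n. X i \<omega>) (\<Sum>i = 1..n. lam)"
    using assms by (intro poisson_variable_sum) (auto simp: iid_poisson_def)
  then have K: "poisson_variable M (\<lambda>\<omega>. \<Sum>i = 1..n. X i \<omega>) (real n * lam)"
    by simp
  have event: "\<bar>z - lam\<bar> < \<epsilon>a \<or> (lam \<noteq> 0 \<and> \<bar>(z - lam) / lam\<bar> < \<epsilon>r) \<longleftrightarrow> \<bar>z - lam\<bar> < max \<epsilon>a (\<epsilon>r * lam)" for z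
    using assms by (cases "lam = 0") (auto simp: less_max_iff_disj abs_divide pos_divide_less_eq)
  have "finite (covered_counts n \<epsilon>a \<epsilon>r lam)"
    by (metis covered_counts_interval[OF \<open>0 < n\<close>] finite_atLeastAtMost)
  from poisson_variable_prob_in[OF K this] show ?thesis
    unfolding coverage_probability_def event by (simp add: sample_mean_def covered_counts_def)
qed

section \<open>Crossings of the interval ends with grid points \<open>k / n\<close>\<close>

text \<open>The lower end is \<open>y - \<epsilon>a\<close> to the left of
  \<open>\<epsilon>a / \<epsilon>r\<close> and \<open>y * (1 - \<epsilon>r)\<close> to the right;
  solving for \<open>y\<close> gives one candidate family on each side. The kink is itself a
  candidate.\<close>

lemma candidate_of_lower_end:
  assumes "0 < \<epsilon>r" "\<epsilon>r < 1" "0 < n" "a < y" "y < b"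
    and eq: "y - max \<epsilon>a (\<epsilon>r * y) = real k / real n"
  shows "y \<in> candidate_set n a b \<epsilon>a \<epsilon>r"
proof -
  consider "y = \<epsilon>a / \<epsilon>r" | "y < \<epsilon>a / \<epsilon>r" | "\<epsilon>a / \<epsilon>r < y" by linarith
  then show ?thesis
  proof cases
    case 2
    then have "\<epsilon>r * y < \<epsilon>a" using assms by (simp add: pos_less_divide_eq mult.commute)
    then have "y = of_int (int k) / real n + \<epsilon>a" using eq by (simp add: max_def split: if_splits)
    then have "\<exists>l::int. y = of_int l / real n + \<epsilon>a" by blast
    then show ?thesis using 2 assms by (simp add: candidate_set_def)
  next
    case 3
    then have "\<epsilon>a < \<epsilon>r * y" using assms by (simp add: pos_divide_less_eq mult.commute)
    then have "y * (1 - \<epsilon>r) = real k / real n" using eq by (simp add: algebra_simps)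
    then have "y = real k / real n / (1 - \<epsilon>r)" using assms by (intro eq_divide_imp) auto
    then have "y = of_int (int k) / (real n * (1 - \<epsilon>r))" by simp
    then have "\<exists>l::int. y = of_int l / (real n * (1 - \<epsilon>r))" by blast
    then show ?thesis using 3 assms by (simp add: candidate_set_def)
  qed (simp add: candidate_set_def)
qed

lemma candidate_of_upper_end:
  assumes "0 < \<epsilon>r" "0 < n" "a < y" "y < b"
    and eq: "y + max \<epsilon>a (\<epsilon>r * y) = real k / real n"
  shows "y \<in> candidate_set n a b \<epsilon>a \<epsilon>r"
proof -
  consider "y = \<epsilon>a / \<epsilon>r" | "y < \<epsilon>a / \<epsilon>r" | "\<epsilon>a / \<epsilon>r < y" by linarith
  then show ?thesis
  proof cases
    case 2
    then have "\<epsilon>r * y < \<epsilon>a" using assms by (simp add: pos_less_divide_eq mult.commute)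
    then have "y = of_int (int k) / real n - \<epsilon>a" using eq by (simp add: max_def split: if_splits)
    then have "\<exists>l::int. y = of_int l / real n - \<epsilon>a" by blast
    then show ?thesis using 2 assms by (simp add: candidate_set_def)
  next
    case 3
    then have "\<epsilon>a < \<epsilon>r * y" using assms by (simp add: pos_divide_less_eq mult.commute)
    then have "y * (1 + \<epsilon>r) = real k / real n" using eq by (simp add: algebra_simps)
    then have "y = real k / real n / (1 + \<epsilon>r)" using assms by (intro eq_divide_imp) auto
    then have "y = of_int (int k) / (real n * (1 + \<epsilon>r))" by simp
    then have "\<exists>l::int. y = of_int l / (real n * (1 + \<epsilon>r))" by blast
    then show ?thesis using 3 assms by (simp add: candidate_set_def)
  qed (simp add: candidate_set_def)
qed

text \<open>Moving right from \<open>q\<close>, the upper end only grows, so a count can be lost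
  only when the lower end reaches \<open>k / n\<close>. By the intermediate value theorem this would
  happen at a candidate in the gap.\<close>

lemma covered_counts_left_subset:
  assumes "0 < \<epsilon>r" "\<epsilon>r < 1" "0 < n" "a \<le> q" "q \<le> lam" "lam < b"
    and gap: "\<And>y. q < y \<Longrightarrow> y \<le> lam \<Longrightarrow> y \<notin> candidate_set n a b \<epsilon>a \<epsilon>r"
  shows "covered_counts n \<epsilon>a \<epsilon>r q \<subseteq> covered_counts n \<epsilon>a \<epsilon>r lam"
proof
  fix k assume k: "k \<in> covered_counts n \<epsilon>a \<epsilon>r q"
  define z where "z = real k / real n"
  have zq: "\<bar>z - q\<bar> < max \<epsilon>a (\<epsilon>r * q)"
    using k by (simp add: covered_counts_def z_def)
  have "\<epsilon>r * q \<le> \<epsilon>r * lam" using assms by simp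
  then have "max \<epsilon>a (\<epsilon>r * q) \<le> max \<epsilon>a (\<epsilon>r * lam)" by simp
  then have upper: "z < lam + max \<epsilon>a (\<epsilon>r * lam)"
    using zq assms by linarith
  have "lam - max \<epsilon>a (\<epsilon>r * lam) < z"
  proof (rule ccontr)
    assume "\<not> ?thesis"
    moreover have q: "q - max \<epsilon>a (\<epsilon>r * q) < z"
      using zq by linarith
    moreover have "continuous_on {q..lam} (\<lambda>y. y - max \<epsilon>a (\<epsilon>r * y))"
      by (intro continuous_intros)
    ultimately obtain y where y: "q \<le> y" "y \<le> lam" "y - max \<epsilon>a (\<epsilon>r * y) = z"
      using IVT'[of "\<lambda>y. y - max \<epsilon>a (\<epsilon>r * y)" q z lam] assms by auto
    \<comment> \<open>Strict coverage at \<open>q\<close> rules out a crossing at \<open>q\<close>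
      itself, which may be a candidate.\<close>
    with q have "q < y" by (cases "q = y") auto
    with y gap show False
      using candidate_of_lower_end[of \<epsilon>r n a y b \<epsilon>a k] assms by (auto simp: z_def)
  qed
  with upper have "\<bar>z - lam\<bar> < max \<epsilon>a (\<epsilon>r * lam)"
    by linarith
  then show "k \<in> covered_counts n \<epsilon>a \<epsilon>r lam"
    by (simp add: covered_counts_def z_def)
qed

text \<open>The mirror image: moving left from \<open>q\<close>, only the upper end can drop a
  count.\<close>

lemma covered_counts_right_subset:
  assumes "0 < \<epsilon>r" "\<epsilon>r < 1" "0 < n" "a < lam" "lam \<le> q" "q \<le> b"
    and gap: "\<And>y. lam \<le> y \<Longrightarrow> y < q \<Longrightarrow> y \<notin> candidate_set n a b \<epsilon>a \<epsilon>r"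
  shows "covered_counts n \<epsilon>a \<epsilon>r q \<subseteq> covered_counts n \<epsilon>a \<epsilon>r lam"
proof
  fix k assume k: "k \<in> covered_counts n \<epsilon>a \<epsilon>r q"
  define z where "z = real k / real n"
  have zq: "\<bar>z - q\<bar> < max \<epsilon>a (\<epsilon>r * q)"
    using k by (simp add: covered_counts_def z_def)
  \<comment> \<open>As \<open>\<epsilon>r < 1\<close>, the half-width grows by at most
    \<open>q - lam\<close>, so the lower end is nondecreasing.\<close>
  have "\<epsilon>r * (q - lam) \<le> 1 * (q - lam)"
    using assms by (intro mult_right_mono) auto
  then have "\<epsilon>r * q \<le> \<epsilon>r * lam + (q - lam)"
    by (simp add: algebra_simps)
  then have "max \<epsilon>a (\<epsilon>r * q) \<le> max \<epsilon>a (\<epsilon>r * lam) + (q - lam)"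
    using assms by linarith
  then have lower: "lam - max \<epsilon>a (\<epsilon>r * lam) < z"
    using zq by linarith
  have "z < lam + max \<epsilon>a (\<epsilon>r * lam)"
  proof (rule ccontr)
    assume "\<not> ?thesis"
    moreover have q: "z < q + max \<epsilon>a (\<epsilon>r * q)"
      using zq by linarith
    moreover have "continuous_on {lam..q} (\<lambda>y. y + max \<epsilon>a (\<epsilon>r * y))"
      by (intro continuous_intros)
    ultimately obtain y where y: "lam \<le> y" "y \<le> q" "y + max \<epsilon>a (\<epsilon>r * y) = z"
      using IVT'[of "\<lambda>y. y + max \<epsilon>a (\<epsilon>r * y)" lam z q] assms by auto
    with q have "y < q" by (cases "q = y") auto
    with y gap show False
      using candidate_of_upper_end[of \<epsilon>r n a y b \<epsilon>a k] assms by (auto simp: z_def)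
  qed
  with lower have "\<bar>z - lam\<bar> < max \<epsilon>a (\<epsilon>r * lam)"
    by linarith
  then show "k \<in> covered_counts n \<epsilon>a \<epsilon>r lam"
    by (simp add: covered_counts_def z_def)
qed

section \<open>Number of candidates\<close>

lemma grid_points_between:
  fixes s t u v :: real
  assumes "0 < s" "u < v"
  defines "G \<equiv> {x \<in> {u<..<v}. \<exists>l::int. x = of_int l / s + t}"
  shows "finite G" "real (card G) < s * (v - u) + 1"
proof -
  \<comment> \<open>These are exactly the integers strictly between \<open>s * (u - t)\<close> and
    \<open>s * (v - t)\<close>; hence the shifts by one at both ends.\<close>
  define L where "L = {\<lfloor>s * (u - t)\<rfloor> + 1..\<lceil>s * (v - t)\<rceil> - 1}"
  have sub: "G \<subseteq> (\<lambda>l. of_int l / s + t) ` L"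
  proof
    fix x assume "x \<in> G"
    then obtain l :: int where l: "x = of_int l / s + t" "u < x" "x < v"
      by (auto simp: G_def)
    then have "of_int l = s * (x - t)"
      using assms(1) by simp
    then have "s * (u - t) < of_int l" "of_int l < s * (v - t)"
      using assms(1) l(2,3) by simp_all
    then have "l \<in> L" unfolding L_def by (auto simp: floor_less_iff less_ceiling_iff) linarith+
    with l show "x \<in> (\<lambda>l. of_int l / s + t) ` L" by blast
  qed
  have "finite L" by (simp add: L_def)
  with sub show "finite G" by (auto intro: finite_subset)
  have "card G \<le> card L"
    using sub \<open>finite L\<close> by (rule surj_card_le[rotated])
  moreover have "real (card L) < s * (v - u) + 1"
  proof -
    have "0 < s * (v - u)" using assms by simp
    then show ?thesis
      unfolding L_def by (simp add: algebra_simps) linarith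
  qed
  ultimately show "real (card G) < s * (v - u) + 1" by linarith
qed

text \<open>Three single points and an excess of 1 for each of four grids give 7. The densities
  \<open>n + n\<close> on the left and \<open>n * (1 + \<epsilon>r) + n * (1 - \<epsilon>r)\<close>
  on the right both equal \<open>2 * n\<close>, so the two lengths add up to
  \<open>b - a\<close>.\<close>

lemma candidate_set_finite_card:
  assumes "0 < \<epsilon>r" "\<epsilon>r < 1" "a < \<epsilon>a / \<epsilon>r" "\<epsilon>a / \<epsilon>r < b" "0 < n"
  shows "finite (candidate_set n a b \<epsilon>a \<epsilon>r)"
    and "real (card (candidate_set n a b \<epsilon>a \<epsilon>r)) < 2 * real n * (b - a) + 7"
proof -
  define e where "e = \<epsilon>a / \<epsilon>r"
  define G where "G s t u v = {x \<in> {u<..<v}. \<exists>l::int. x = of_int l / s + t}" for s t u v :: real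
  note grid = grid_points_between[folded G_def]
  have cand: "candidate_set n a b \<epsilon>a \<epsilon>r = {a, b, e} \<union> G n \<epsilon>a a e \<union> G n (- \<epsilon>a) a e
      \<union> G (n * (1 + \<epsilon>r)) 0 e b \<union> G (n * (1 - \<epsilon>r)) 0 e b"
    by (simp add: candidate_set_def G_def e_def)
  have e: "a < e" "e < b" using assms by (auto simp: e_def)
  have pos: "0 < real n" "0 < real n * (1 + \<epsilon>r)" "0 < real n * (1 - \<epsilon>r)"
    using assms by auto
  show "finite (candidate_set n a b \<epsilon>a \<epsilon>r)"
    unfolding cand using grid(1) pos e by simp
  have "card (candidate_set n a b \<epsilon>a \<epsilon>r) \<le> card {a, b, e} + card (G n \<epsilon>a a e) + card (G n (- \<epsilon>a) a e)
      + card (G (n * (1 + \<epsilon>r)) 0 e b) + card (G (n * (1 - \<epsilon>r)) 0 e b)"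
    unfolding cand by (meson add_le_mono card_Un_le le_refl order_trans)
  moreover have "card {a, b, e} \<le> 3"
    by (simp add: card_insert_if)
  ultimately have "real (card (candidate_set n a b \<epsilon>a \<epsilon>r)) < 3 + (n * (e - a) + 1) + (n * (e - a) + 1)
      + (n * (1 + \<epsilon>r) * (b - e) + 1) + (n * (1 - \<epsilon>r) * (b - e) + 1)"
    using grid(2)[OF pos(1) e(1), of \<epsilon>a] grid(2)[OF pos(1) e(1), of "- \<epsilon>a"]
      grid(2)[OF pos(2) e(2), of 0] grid(2)[OF pos(3) e(2), of 0]
    by linarith
  also have "\<dots> = 2 * real n * (b - a) + 7"
    by (simp add: algebra_simps)
  finally show "real (card (candidate_set n a b \<epsilon>a \<epsilon>r)) < 2 * real n * (b - a) + 7" .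
qed

section \<open>Minimum of the coverage probability over \<open>{a..b}\<close>\<close>

theorem theorem3:
  fixes a b \<epsilon>a \<epsilon>r :: real and n :: nat
    and M :: "real \<Rightarrow> 'a measure" and X :: "real \<Rightarrow> nat \<Rightarrow> 'a \<Rightarrow> nat"
  assumes "0 < \<epsilon>a" "\<epsilon>a < 1" "0 < \<epsilon>r" "\<epsilon>r < 1"
    and "0 \<le> a" "a < \<epsilon>a / \<epsilon>r" "\<epsilon>a / \<epsilon>r < b"
    and "0 < n"
    and "\<And>lam. lam \<in> {a..b} \<Longrightarrow> iid_poisson (M lam) (X lam) n lam"
  shows "(\<exists>q \<in> candidate_set n a b \<epsilon>a \<epsilon>r. q \<in> {a..b} \<and>
            (\<forall>lam \<in> {a..b}. coverage_probability (M q) (X q) n \<epsilon>a \<epsilon>r q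
                            \<le> coverage_probability (M lam) (X lam) n \<epsilon>a \<epsilon>r lam))
         \<and> finite (candidate_set n a b \<epsilon>a \<epsilon>r)
         \<and> real (card (candidate_set n a b \<epsilon>a \<epsilon>r)) < 2 * real n * (b - a) + 7"
proof -
  define F where "F = candidate_set n a b \<epsilon>a \<epsilon>r"
  define C where "C lam = coverage_probability (M lam) (X lam) n \<epsilon>a \<epsilon>r lam" for lam
  have F: "finite F" "real (card F) < 2 * real n * (b - a) + 7"
    using candidate_set_finite_card assms unfolding F_def by blast+
  have ends: "a \<in> F" "b \<in> F" by (simp_all add: F_def candidate_set_def)
  have F_sub: "F \<subseteq> {a..b}" using assms by (auto simp: F_def candidate_set_def)
  have C_eq: "C x = (\<Sum>k \<in> covered_counts n \<epsilon>a \<epsilon>r x. poisson_mass k (real n * x))" if "x \<in> {a..b}" for x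
    unfolding C_def using that assms by (intro coverage_probability_eq_sum) auto
  \<comment> \<open>The candidate may depend on \<open>lam\<close> here; finiteness of
    \<open>F\<close> later yields a single minimizer.\<close>
  have better: "\<exists>q\<in>F. C q \<le> C lam" if lam: "lam \<in> {a..b}" for lam
  proof (cases "lam \<in> F")
    case False
    then have ab: "a < lam" "lam < b" using lam ends by (auto simp: order_less_le)
    \<comment> \<open>The candidates adjacent to \<open>lam\<close>; they exist because
      \<open>a\<close> and \<open>b\<close> are candidates.\<close>
    define u where "u = Max {q \<in> F. q < lam}"
    define v where "v = Min {q \<in> F. lam < q}"
    have fin: "finite {q \<in> F. q < lam}" "finite {q \<in> F. lam < q}" using F by auto
    have "u \<in> {q \<in> F. q < lam}" "v \<in> {q \<in> F. lam < q}"
      unfolding u_def v_def using fin ends ab by (intro Max_in Min_in; blast)+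
    then have uv: "u \<in> F" "u < lam" "v \<in> F" "lam < v" by auto
    have gap: "y \<notin> F" if "u < y" "y < v" for y
      using that False Max_ge[OF fin(1), of y] Min_le[OF fin(2), of y]
      unfolding u_def[symmetric] v_def[symmetric] by (cases y lam rule: linorder_cases) auto
    obtain c d where cd: "covered_counts n \<epsilon>a \<epsilon>r lam = {c..d}"
      using covered_counts_interval[OF \<open>0 < n\<close>] by metis
    \<comment> \<open>\<open>g\<close> freezes the range of summation at the one belonging to
      \<open>lam\<close>. It agrees with \<open>C\<close> at \<open>lam\<close> and dominates
      \<open>C\<close> at \<open>u\<close> and \<open>v\<close>, where the range can only be smaller
      and the masses are nonnegative.\<close>
    define g where "g x = (\<Sum>k = c..d. poisson_mass k (real n * x))" for x
    have ge_a: "a \<le> u" "v \<le> b" using uv F_sub by auto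
    have "covered_counts n \<epsilon>a \<epsilon>r u \<subseteq> {c..d}"
      unfolding cd[symmetric] using assms uv ge_a ab gap
      by (intro covered_counts_left_subset[of _ _ a _ _ b]) (auto simp: F_def)
    moreover have "covered_counts n \<epsilon>a \<epsilon>r v \<subseteq> {c..d}"
      unfolding cd[symmetric] using assms uv ge_a ab gap
      by (intro covered_counts_right_subset[of _ _ a _ _ b]) (auto simp: F_def)
    ultimately have "C u \<le> g u" "C v \<le> g v"
      using assms uv ge_a ab
      by (auto simp: C_eq g_def intro!: sum_mono2 poisson_mass_nonneg)
    moreover have "min (g u) (g v) \<le> g lam"
      unfolding g_def using assms uv ge_a by (intro sum_poisson_mass_quasi_concave) auto
    moreover have "C lam = g lam"
      using lam by (simp add: C_eq g_def cd)
    ultimately have "C u \<le> C lam \<or> C v \<le> C lam" by linarith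
    then show ?thesis using uv by blast
  qed blast
  obtain q where q: "q \<in> F" "\<And>p. p \<in> F \<Longrightarrow> C q \<le> C p"
    using ex_min_if_finite[of "C ` F"] F(1) ends by (metis arg_min_if_finite empty_iff linorder_not_le)
  have "\<forall>lam\<in>{a..b}. C q \<le> C lam"
    using better q order_trans by metis
  then show ?thesis
    using q(1) F F_sub unfolding F_def C_def by blast
qed

end
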